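(* Let $n\ge2$ and $k\ge1$ be integers, and let $S_\infty^{n-1}:=\{x\in\mathbb{R}^n:\|x\|_\infty=1\}$. The global minimum of $h_{2k}$ on $S_\infty^{n-1}$ is always attained at a point of the form $(\underbrace{t,\ldots,t}_{n-1},1)$, where $t$ is the unique root of $$\varphi_{k,n}(t):=h_{2k-1}(\underbrace{t,\ldots,t}_{n},1)$$ in $(-1,0)$. Moreover, the value of $h_{2k}$ at this vector equals $$\binom{n+2k-1}{2k}\,t^{2k}.$$
   Context: For an integer $m\ge 0$ and any number of variables, $h_m$ denotes the complete homogeneous symmetric polynomial of degree $m$: $h_m(a_1,\ldots,a_N)=\sum_{1\le i_1\le\cdots\le i_m\le N}a_{i_1}\cdots a_{i_m}$, with $h_0=1$. Here $\|x\|_\infty=\max_i|x_i|$. *)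

theory Defs
  imports Complex_Main
begin

text \<open>
  Vectors with an arbitrary number of entries are lists; \<open>\<real>\<^sup>n\<close> is the set of real lists of
  length \<open>n\<close>. The statement evaluates complete homogeneous polynomials both in \<open>n\<close> and in \<open>n + 1\<close>
  variables, so the number of variables cannot be fixed by an index type.
\<close>

text \<open>The list \<open>js\<close> is the weakly increasing sequence \<open>i\<^sub>1 \<le> \<dots> \<le> i\<^sub>m\<close>, with indices counted from 0.\<close>

definition complete_hom :: "nat \<Rightarrow> 'a::comm_semiring_1 list \<Rightarrow> 'a" where
  "complete_hom m a =
     (\<Sum>js | length js = m \<and> sorted js \<and> set js \<subseteq> {..<length a}. \<Prod>i\<leftarrow>js. a ! i)"

lemma finite_complete_hom_index:
  "finite {js. length js = m \<and> sorted js \<and> set js \<subseteq> {..<N::nat}}"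
  by (rule finite_subset[OF _ finite_lists_length_eq[of "{..<N}" m]]) auto

lemma complete_hom_0: "complete_hom 0 a = 1"
proof -
  have "{js. length js = 0 \<and> sorted js \<and> set js \<subseteq> {..<length a}} = {[]}"
    by auto
  then show ?thesis
    by (simp add: complete_hom_def)
qed

text \<open>Only meaningful for nonempty lists.\<close>

definition max_norm :: "real list \<Rightarrow> real" where
  "max_norm x = Max (abs ` set x)"

definition max_sphere :: "nat \<Rightarrow> real list set" where
  "max_sphere n = {x. length x = n \<and> max_norm x = 1}"

definition phi :: "nat \<Rightarrow> nat \<Rightarrow> real \<Rightarrow> real" where
  "phi k n t = complete_hom (2 * k - 1) (replicate n t @ [1])"

end

theory Submission
  imports Defs "HOL-Computational_Algebra.Formal_Power_Series" "HOL-Library.Multiset"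
begin

text \<open>
  Write \<open>h\<^sub>m\<close> for the complete homogeneous polynomial of degree \<open>m\<close>. It is the coefficient of
  \<open>X\<^sup>m\<close> in the product of the series \<open>1 / (1 - x X)\<close> over the variables \<open>x\<close>, so it depends only on
  the multiset of variables, and identities between rational functions of \<open>X\<close> become identities
  for \<open>h\<^sub>m\<close>. Two of them carry the proof:

  \<^item> \<open>h\<^sub>m\<^sub>+\<^sub>1(a, Z) - h\<^sub>m\<^sub>+\<^sub>1(b, Z) = (a - b) h\<^sub>m(a, b, Z)\<close>, a divided difference
    (\<open>chom_divided_difference\<close>);
  \<^item> \<open>h\<^sub>m\<^sub>+\<^sub>2(a, b, Z) - h\<^sub>m\<^sub>+\<^sub>2(c, d, Z) = (c d - a b) h\<^sub>m(a, b, c, d, Z)\<close> whenever \<open>a + b = c + d\<close>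
    (\<open>chom_smoothing\<close>).

  If \<open>h\<^sub>m\<close> is nonnegative in every number of variables, the second identity says that moving two
  variables towards each other, with their sum fixed, does not increase \<open>h\<^sub>m\<^sub>+\<^sub>2\<close>. Finitely many such
  moves replace any group of variables by copies of their mean (\<open>chom_mean_le\<close>). Applied to
  all variables this bounds \<open>h\<^sub>m\<^sub>+\<^sub>2\<close> below by a multiple of a power of the mean, so that by induction
  every \<open>h\<^sub>2\<^sub>k\<close> is nonnegative: Hunter's theorem (\<open>chom_even_nonneg\<close>).

  By homogeneity and evenness it suffices to bound \<open>h\<^sub>2\<^sub>k\<close> below when one variable is \<open>1\<close>. Smoothing
  the other \<open>n - 1\<close> variables to their mean leaves a problem in one variable \<open>s\<close>, namely
  minimising \<open>h\<^sub>2\<^sub>k(s, \<dots>, s, 1)\<close>. By the divided differences its derivative is a positive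
  multiple of \<open>\<phi>(s)\<close>, and \<open>\<phi>\<close> is increasing because \<open>h\<^bsub>2k-2\<^esub> \<ge> 0\<close>. Hence every root \<open>t\<close> of \<open>\<phi>\<close>
  gives a global minimum (\<open>chom_critical_le\<close>). If \<open>\<phi>(t) = 0\<close>, then appending one more \<open>t\<close> to
  \<open>(t, \<dots>, t, 1)\<close> and afterwards deleting the \<open>1\<close> does not change \<open>h\<^sub>2\<^sub>k\<close>; so the minimum is the
  value at \<open>n\<close> copies of \<open>t\<close>, which is \<open>t\<^sup>2\<^sup>k\<close> times the number of monomials.

  A root exists in \<open>(-1, 0)\<close> by the intermediate value theorem. It is unique because two roots in
  \<open>(-1, 0)\<close> give the same minimal value, hence have the same \<open>2k\<close>-th power.
\<close>

section \<open>Complete homogeneous polynomials of a multiset\<close>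

unbundle fps_syntax

definition chom_gf :: "'a::field multiset \<Rightarrow> 'a fps" where
  "chom_gf M = (\<Prod>x\<in>#M. inverse (1 - fps_const x * fps_X))"

definition chom :: "nat \<Rightarrow> 'a::field multiset \<Rightarrow> 'a" where
  "chom m M = chom_gf M $ m"

lemma chom_gf_empty: "chom_gf {#} = 1"
  by (simp add: chom_gf_def)

lemma inverse_linear_fps: "(1 - fps_const x * fps_X) * inverse (1 - fps_const x * fps_X) = 1"
  for x :: "'a::field"
  by (rule inverse_mult_eq_1') simp

lemma chom_gf_add_mset: "(1 - fps_const x * fps_X) * chom_gf (add_mset x M) = chom_gf M"
  unfolding chom_gf_def image_mset_add_mset prod_mset.add_mset mult.assoc [symmetric]
    inverse_linear_fps by simp

lemma chom_0 [simp]: "chom 0 M = 1"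
proof (induction M)
  case (add x M)
  have "((1 - fps_const x * fps_X) * chom_gf (add_mset x M)) $ 0 = chom_gf M $ 0"
    by (simp only: chom_gf_add_mset)
  with add show ?case
    by (simp add: chom_def)
qed (simp add: chom_def chom_gf_empty)

lemma chom_Suc_empty [simp]: "chom (Suc m) {#} = 0"
  by (simp add: chom_def chom_gf_empty)

lemma chom_Suc_add_mset:
  "chom (Suc m) (add_mset x M) = chom (Suc m) M + x * chom m (add_mset x M)"
proof -
  have "((1 - fps_const x * fps_X) * chom_gf (add_mset x M)) $ Suc m = chom_gf M $ Suc m"
    by (simp only: chom_gf_add_mset)
  then show ?thesis
    by (simp add: chom_def algebra_simps)
qed

text \<open>
  A weakly increasing index list for \<open>length a + 1\<close> variables either avoids the last
  variable or ends with it.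
\<close>
lemma complete_hom_Suc_snoc:
  "complete_hom (Suc m) (a @ [x]) = complete_hom (Suc m) a + x * complete_hom m (a @ [x])"
proof -
  define I where "I m N = {js. length js = m \<and> sorted js \<and> set js \<subseteq> {..<N::nat}}" for m N
  let ?N = "length a"
  have fin: "finite (I m N)" for m N
    unfolding I_def by (rule finite_complete_hom_index)
  have split: "I (Suc m) (Suc ?N) = I (Suc m) ?N \<union> (\<lambda>js. js @ [?N]) ` I m (Suc ?N)"
    (is "?L = ?R")
  proof (intro equalityI subsetI)
    fix js assume js: "js \<in> ?L"
    then obtain ks i where eq: "js = ks @ [i]"
      by (cases js rule: rev_cases) (auto simp: I_def)
    show "js \<in> ?R"
    proof (cases "i = ?N")
      case True
      then show ?thesis
        using js eq by (auto simp: I_def sorted_append)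
    next
      case False
      then have "i < ?N"
        using js eq by (auto simp: I_def)
      then show ?thesis
        using js eq by (fastforce simp: I_def sorted_append)
    qed
  next
    fix js assume "js \<in> ?R"
    then show "js \<in> ?L"
      by (fastforce simp: I_def sorted_append less_Suc_eq_le)
  qed
  have disj: "I (Suc m) ?N \<inter> (\<lambda>js. js @ [?N]) ` I m (Suc ?N) = {}"
    by (auto simp: I_def)
  have prod_eq: "(\<Prod>i\<leftarrow>js. (a @ [x]) ! i) = (\<Prod>i\<leftarrow>js. a ! i)" if "js \<in> I (Suc m) ?N" for js
    using that by (intro arg_cong[where f = prod_list] map_cong) (auto simp: I_def nth_append)
  have "complete_hom (Suc m) (a @ [x]) = (\<Sum>js\<in>I (Suc m) (Suc ?N). \<Prod>i\<leftarrow>js. (a @ [x]) ! i)"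
    by (simp add: complete_hom_def I_def)
  also have "\<dots> = (\<Sum>js\<in>I (Suc m) ?N. \<Prod>i\<leftarrow>js. (a @ [x]) ! i)
      + (\<Sum>js\<in>(\<lambda>js. js @ [?N]) ` I m (Suc ?N). \<Prod>i\<leftarrow>js. (a @ [x]) ! i)"
    unfolding split by (rule sum.union_disjoint) (use fin disj in auto)
  also have "(\<Sum>js\<in>I (Suc m) ?N. \<Prod>i\<leftarrow>js. (a @ [x]) ! i) = complete_hom (Suc m) a"
    unfolding complete_hom_def I_def[symmetric] by (rule sum.cong) (use prod_eq in auto)
  also have "(\<Sum>js\<in>(\<lambda>js. js @ [?N]) ` I m (Suc ?N). \<Prod>i\<leftarrow>js. (a @ [x]) ! i)
      = x * complete_hom m (a @ [x])"
    by (subst sum.reindex)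
      (auto simp: inj_on_def complete_hom_def I_def sum_distrib_left mult.commute)
  finally show ?thesis .
qed

lemma complete_hom_Suc_Nil: "complete_hom (Suc m) [] = 0"
  unfolding complete_hom_def by (rule sum.neutral) auto

lemma complete_hom_eq_chom: "complete_hom m a = chom m (mset a)"
proof (induction a arbitrary: m rule: rev_induct)
  case Nil
  show ?case
    by (cases m) (simp_all add: complete_hom_0 complete_hom_Suc_Nil)
next
  case (snoc x a)
  show ?case
  proof (induction m)
    case 0
    show ?case
      by (simp add: complete_hom_0)
  next
    case (Suc m)
    then show ?case
      by (simp add: complete_hom_Suc_snoc chom_Suc_add_mset snoc.IH)
  qed
qed

lemma chom_replicate:
  "chom m (replicate_mset n t) = of_nat ((n + m - 1) choose m) * t ^ m"
proof (induction n arbitrary: m)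
  case 0
  show ?case
    by (cases m) (simp_all add: binomial_eq_0)
next
  case (Suc n)
  note IH = Suc.IH
  show ?case
  proof (induction m)
    case (Suc m)
    have "(Suc n + Suc m - 1) choose Suc m = ((n + m) choose Suc m) + ((n + m) choose m)"
      by simp
    with Suc show ?case
      using IH[of "Suc m"] by (simp add: chom_Suc_add_mset algebra_simps)
  qed simp
qed

lemma chom_homogeneous: "chom m (image_mset ((*) c) M) = c ^ m * chom m M"
proof (induction M arbitrary: m)
  case empty
  show ?case
    by (cases m) simp_all
next
  case (add x M)
  show ?case
  proof (induction m)
    case (Suc m)
    then show ?case
      by (simp add: chom_Suc_add_mset add.IH distrib_left mult.assoc mult.left_commute)
  qed simp
qed

lemma chom_add_one: "chom m (add_mset 1 M) = (\<Sum>j\<le>m. chom j M)"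
  by (induction m) (simp_all add: chom_Suc_add_mset)

text \<open>
  Over a common denominator, \<open>1 / (1 - a X) - 1 / (1 - b X)\<close> has numerator \<open>(a - b) X\<close>.
\<close>
lemma chom_divided_difference:
  "chom (Suc m) (add_mset a Z) - chom (Suc m) (add_mset b Z)
    = (a - b) * chom m (add_mset a (add_mset b Z))"
proof -
  let ?P = "chom_gf (add_mset a (add_mset b Z))"
  have a: "(1 - fps_const b * fps_X) * ?P = chom_gf (add_mset a Z)"
    by (subst add_mset_commute) (rule chom_gf_add_mset)
  have b: "(1 - fps_const a * fps_X) * ?P = chom_gf (add_mset b Z)"
    by (rule chom_gf_add_mset)
  have "chom_gf (add_mset a Z) - chom_gf (add_mset b Z) = fps_X * (fps_const (a - b) * ?P)"
    unfolding a[symmetric] b[symmetric] by (simp add: algebra_simps flip: fps_const_sub)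
  then have "(chom_gf (add_mset a Z) - chom_gf (add_mset b Z)) $ Suc m
      = (fps_X * (fps_const (a - b) * ?P)) $ Suc m"
    by simp
  then show ?thesis
    by (simp add: chom_def)
qed

text \<open>
  The numerator of \<open>1 / ((1 - a X)(1 - b X)) - 1 / ((1 - c X)(1 - d X))\<close> loses its linear term
  when \<open>a + b = c + d\<close>, and only \<open>(c d - a b) X\<^sup>2\<close> remains.
\<close>
lemma chom_smoothing:
  assumes "a + b = c + d"
  shows "chom (m + 2) (add_mset a (add_mset b Z)) - chom (m + 2) (add_mset c (add_mset d Z))
    = (c * d - a * b) * chom m (add_mset a (add_mset b (add_mset c (add_mset d Z))))"
proof -
  let ?l = "\<lambda>x. 1 - fps_const x * fps_X"
  let ?P = "chom_gf (add_mset a (add_mset b (add_mset c (add_mset d Z))))"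
  have cd: "?l b * (?l a * ?P) = chom_gf (add_mset c (add_mset d Z))"
    by (simp only: chom_gf_add_mset)
  have "add_mset a (add_mset b (add_mset c (add_mset d Z)))
      = add_mset c (add_mset d (add_mset a (add_mset b Z)))"
    by (simp add: add_mset_commute)
  then have ab: "?l d * (?l c * ?P) = chom_gf (add_mset a (add_mset b Z))"
    by (simp only: chom_gf_add_mset)
  have d: "d = a + b - c"
    using assms by simp
  have "chom_gf (add_mset a (add_mset b Z)) - chom_gf (add_mset c (add_mset d Z))
      = fps_X * (fps_X * (fps_const (c * d - a * b) * ?P))"
    unfolding ab[symmetric] cd[symmetric] unfolding d
    by (simp add: algebra_simps flip: fps_const_sub fps_const_add fps_const_mult)
  then have "(chom_gf (add_mset a (add_mset b Z)) - chom_gf (add_mset c (add_mset d Z))) $ (m + 2)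
      = (fps_X * (fps_X * (fps_const (c * d - a * b) * ?P))) $ (m + 2)"
    by simp
  then show ?thesis
    by (simp add: chom_def)
qed

section \<open>Smoothing and positivity in even degree\<close>

lemma sum_mset_less_size_mult:
  fixes M :: "'a::linordered_field multiset"
  assumes "M \<noteq> {#}" and "\<And>x. x \<in># M \<Longrightarrow> x < \<mu>"
  shows "sum_mset M < of_nat (size M) * \<mu>"
  using assms
proof (induction M)
  case (add x M)
  then show ?case
    by (cases "M = {#}") (auto simp: distrib_right intro: add_strict_mono)
qed simp

lemma exists_mset_ge_mean:
  fixes M :: "'a::linordered_field multiset"
  assumes "M \<noteq> {#}" and "of_nat (size M) * \<mu> \<le> sum_mset M"
  obtains b where "b \<in># M" and "\<mu> \<le> b"
  using sum_mset_less_size_mult[of M \<mu>] assms by (meson not_le)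

lemma exists_mset_le_mean:
  fixes M :: "'a::linordered_field multiset"
  assumes "M \<noteq> {#}" and "sum_mset M \<le> of_nat (size M) * \<mu>"
  obtains a where "a \<in># M" and "a \<le> \<mu>"
proof -
  have "sum_mset (image_mset uminus M) = - sum_mset M"
    by (induction M) simp_all
  then obtain b where "b \<in># image_mset uminus M" "- \<mu> \<le> b"
    using exists_mset_ge_mean[of "image_mset uminus M" "- \<mu>"] assms by auto
  then show ?thesis
    using that by auto
qed

text \<open>
  One smoothing step replaces elements \<open>a \<le> \<mu> \<le> b\<close> by \<open>\<mu>\<close> and \<open>a + b - \<mu>\<close>. It keeps the mean and
  settles one variable for good, so that at most \<open>size M\<close> steps make all variables equal to \<open>\<mu>\<close>.
\<close>
lemma chom_mean_le:
  fixes M Z :: "'a::linordered_field multiset"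
  assumes nonneg: "\<And>N :: 'a multiset. 0 \<le> chom m N"
    and "sum_mset M = of_nat (size M) * \<mu>"
  shows "chom (m + 2) (replicate_mset (size M) \<mu> + Z) \<le> chom (m + 2) (M + Z)"
  using assms(2)
proof (induction "size M" arbitrary: M Z)
  case 0
  then show ?case
    by simp
next
  case (Suc n)
  from Suc(2) have "M \<noteq> {#}"
    by auto
  then obtain a where a: "a \<in># M" "a \<le> \<mu>"
    using exists_mset_le_mean[of M \<mu>] Suc(3) by auto
  then obtain M' where M': "M = add_mset a M'"
    by (meson multi_member_split)
  show ?case
  proof (cases "M' = {#}")
    case True
    then show ?thesis
      using Suc(3) M' by simp
  next
    case False
    have "of_nat (size M') * \<mu> \<le> sum_mset M'"
      using Suc(3) a(2) M' by (simp add: distrib_right)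
    then obtain b where b: "b \<in># M'" "\<mu> \<le> b"
      using exists_mset_ge_mean[OF False] by auto
    then obtain M'' where M'': "M' = add_mset b M''"
      by (meson multi_member_split)
    let ?N = "add_mset (a + b - \<mu>) M''"
    have size: "n = size ?N" "size M = Suc (size ?N)"
      using Suc(2) M' M'' by simp_all
    have "sum_mset ?N = of_nat (size ?N) * \<mu>"
      using Suc(3) M' M'' by (simp add: distrib_right)
    then have "chom (m + 2) (replicate_mset (size ?N) \<mu> + add_mset \<mu> Z)
        \<le> chom (m + 2) (?N + add_mset \<mu> Z)"
      by (rule Suc(1)[OF size(1)])
    also have "\<dots> = chom (m + 2) (add_mset \<mu> (add_mset (a + b - \<mu>) (M'' + Z)))"
      by (simp add: add_mset_commute)
    also have "\<dots> \<le> chom (m + 2) (add_mset a (add_mset b (M'' + Z)))"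
    proof -
      have "\<mu> * (a + b - \<mu>) - a * b = (\<mu> - a) * (b - \<mu>)"
        by (simp add: algebra_simps)
      then have "0 \<le> \<mu> * (a + b - \<mu>) - a * b"
        using a(2) b(2) by simp
      then have "0 \<le> chom (m + 2) (add_mset a (add_mset b (M'' + Z)))
          - chom (m + 2) (add_mset \<mu> (add_mset (a + b - \<mu>) (M'' + Z)))"
        by (subst chom_smoothing) (simp_all add: nonneg)
      then show ?thesis
        by simp
    qed
    finally show ?thesis
      using size M' M'' by simp
  qed
qed

text \<open>
  Hunter's theorem. The induction over the degree works in all numbers of variables at once,
  because smoothing in degree \<open>2k + 2\<close> uses degree \<open>2k\<close> with two more variables.
\<close>
theorem chom_even_nonneg:
  fixes M :: "'a::linordered_field multiset"
  shows "0 \<le> chom (2 * k) M"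
proof (induction k arbitrary: M)
  case 0
  show ?case
    by simp
next
  case (Suc k)
  define \<mu> where "\<mu> = sum_mset M / of_nat (size M)"
  have "sum_mset M = of_nat (size M) * \<mu>"
    by (cases "M = {#}") (simp_all add: \<mu>_def)
  then have "chom (2 * k + 2) (replicate_mset (size M) \<mu> + {#}) \<le> chom (2 * k + 2) (M + {#})"
    by (intro chom_mean_le Suc)
  moreover have "0 \<le> chom (2 * Suc k) (replicate_mset (size M) \<mu>)"
    unfolding chom_replicate by (intro mult_nonneg_nonneg zero_le_even_power) simp_all
  ultimately show ?case
    by simp
qed

section \<open>The problem in one variable\<close>

lemma chom_replicate_mono:
  fixes Z :: "'a::linordered_field multiset"
  assumes nonneg: "\<And>N :: 'a multiset. 0 \<le> chom m N" and "s \<le> t"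
  shows "chom (Suc m) (replicate_mset p s + Z) \<le> chom (Suc m) (replicate_mset p t + Z)"
proof (induction p arbitrary: Z)
  case (Suc p)
  have "0 \<le> (t - s) * chom m (add_mset t (add_mset s (replicate_mset p s + Z)))"
    using nonneg \<open>s \<le> t\<close> by simp
  then have "chom (Suc m) (add_mset s (replicate_mset p s + Z))
      \<le> chom (Suc m) (add_mset t (replicate_mset p s + Z))"
    unfolding chom_divided_difference[symmetric] by simp
  also have "\<dots> \<le> chom (Suc m) (add_mset t (replicate_mset p t + Z))"
    using Suc[of "add_mset t Z"] by simp
  finally show ?case
    by simp
qed simp

text \<open>
  The hypothesis on \<open>t\<close> says that the derivative of \<open>s \<mapsto> h(s, \<dots>, s, Z)\<close> vanishes at \<open>t\<close>. The
  values at \<open>t\<close> and \<open>s\<close> are compared by changing one copy of \<open>t\<close> into \<open>s\<close> at a time: each change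
  adds \<open>s - t\<close> times a value that has the sign of \<open>s - t\<close> by monotonicity.
\<close>
lemma chom_critical_le:
  fixes Z :: "'a::linordered_field multiset"
  assumes nonneg: "\<And>N :: 'a multiset. 0 \<le> chom m N"
    and root: "chom (Suc m) (replicate_mset (Suc p) t + Z) = 0"
  shows "chom (m + 2) (replicate_mset p t + Z) \<le> chom (m + 2) (replicate_mset p s + Z)"
proof -
  have "chom (m + 2) (replicate_mset p t + Z)
      \<le> chom (m + 2) (replicate_mset i s + replicate_mset (p - i) t + Z)" if "i \<le> p" for i
    using that
  proof (induction i)
    case (Suc i)
    define q where "q = p - Suc i"
    have q: "p - i = Suc q" "Suc p = Suc i + Suc q"
      using Suc.prems by (simp_all add: q_def)
    let ?R = "replicate_mset i s + replicate_mset q t + Z"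
    have R: "add_mset s (add_mset t ?R) = replicate_mset (Suc i) s + (replicate_mset (Suc q) t + Z)"
      by simp
    have T: "replicate_mset (Suc p) t + Z = replicate_mset (Suc i) t + (replicate_mset (Suc q) t + Z)"
      unfolding q(2) by (rule multiset_eqI) simp
    have "0 \<le> (s - t) * chom (Suc m) (add_mset s (add_mset t ?R))"
    proof (cases "s \<le> t")
      case True
      then have "chom (Suc m) (add_mset s (add_mset t ?R)) \<le> 0"
        using chom_replicate_mono[OF nonneg True, of "Suc i" "replicate_mset (Suc q) t + Z"] root
        unfolding R T by simp
      with True show ?thesis
        by (simp add: mult_nonpos_nonpos)
    next
      case False
      then have "t \<le> s"
        by simp
      then have "0 \<le> chom (Suc m) (add_mset s (add_mset t ?R))"
        using chom_replicate_mono[OF nonneg, of t s "Suc i" "replicate_mset (Suc q) t + Z"] root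
        unfolding R T by simp
      with \<open>t \<le> s\<close> show ?thesis
        by simp
    qed
    then have "chom (m + 2) (add_mset t ?R) \<le> chom (m + 2) (add_mset s ?R)"
      unfolding chom_divided_difference[symmetric] by simp
    with Suc q show ?case
      by (simp add: q_def)
  qed simp
  from this[of p] show ?thesis
    by simp
qed

section \<open>The polynomial \<open>\<phi>\<close> and the minimum\<close>

lemma phi_eq_chom: "phi k n t = chom (2 * k - 1) (add_mset 1 (replicate_mset n t))"
  by (simp add: phi_def complete_hom_eq_chom)

lemma phi_eq_sum: "phi k n t = (\<Sum>j\<le>2 * k - 1. real ((n + j - 1) choose j) * t ^ j)"
  by (simp add: phi_eq_chom chom_add_one chom_replicate)

text \<open>
  In degree \<open>2k - 1\<close> the alternating sum pairs each even term with the next odd one, whose binomial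
  coefficient is larger by Pascal's rule, strictly since \<open>n \<ge> 2\<close>.
\<close>
lemma phi_minus_one_neg:
  assumes "n \<ge> 2" and "k \<ge> 1"
  shows "phi k n (-1) < 0"
proof -
  let ?f = "\<lambda>j. real ((n + j - 1) choose j) * (-1) ^ j"
  obtain p where p: "n = Suc (Suc p)"
    using assms(1) by (metis add_2_eq_Suc le_Suc_ex)
  have "(\<Sum>j\<le>Suc (2 * i). ?f j) < 0" for i
  proof (induction i)
    case 0
    show ?case
      using p by simp
  next
    case (Suc i)
    define u where "u = 2 * i + 2"
    have even: "even u"
      by (simp add: u_def)
    have "?f u + ?f (Suc u) = - real ((p + Suc u) choose Suc u)"
      using even by (simp add: p)
    moreover have "0 < (p + Suc u) choose Suc u"
      by simp
    ultimately have "?f u + ?f (Suc u) < 0"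
      by linarith
    moreover have "(\<Sum>j\<le>Suc (2 * Suc i). ?f j) = (\<Sum>j\<le>Suc (2 * i). ?f j) + (?f u + ?f (Suc u))"
      by (simp add: u_def)
    ultimately show ?case
      using Suc by linarith
  qed
  moreover have "2 * k - 1 = Suc (2 * (k - 1))"
    using assms(2) by simp
  ultimately show ?thesis
    unfolding phi_eq_sum by metis
qed

lemma phi_root_exists:
  assumes "n \<ge> 2" and "k \<ge> 1"
  obtains t where "t \<in> {-1<..<0}" and "phi k n t = 0"
proof -
  have cont: "continuous_on {-1..0} (phi k n)"
    unfolding phi_eq_sum by (intro continuous_intros)
  have zero: "phi k n 0 = 1"
    by (simp add: phi_eq_sum power_0_left if_distrib cong: if_cong)
  have neg: "phi k n (-1) < 0"
    by (rule phi_minus_one_neg[OF assms])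
  obtain t where t: "-1 \<le> t" "t \<le> 0" "phi k n t = 0"
    using IVT'[of "phi k n" "-1" 0 0] cont zero neg by auto
  then have "t \<noteq> -1" "t \<noteq> 0"
    using zero neg by auto
  with t show ?thesis
    by (intro that[of t]) auto
qed

text \<open>
  At a root of \<open>\<phi>\<close> both recursions for \<open>h\<^sub>2\<^sub>k(t, \<dots>, t, 1)\<close>, with \<open>n\<close> copies of \<open>t\<close>, lose
  their second term: removing one \<open>t\<close>, or removing the \<open>1\<close>, leaves the value unchanged.
\<close>
lemma complete_hom_at_root:
  assumes "n \<ge> 1" and "k \<ge> 1" and root: "phi k n t = 0"
  shows "complete_hom (2 * k) (replicate (n - 1) t @ [1]) = real ((n + 2 * k - 1) choose (2 * k)) * t ^ (2 * k)"
proof -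
  have k: "2 * k = Suc (2 * k - 1)"
    using assms(2) by simp
  have n: "replicate_mset n t = add_mset t (replicate_mset (n - 1) t)"
    using assms(1) by (cases n) simp_all
  have "chom (2 * k) (add_mset t (add_mset 1 (replicate_mset (n - 1) t)))
      = chom (2 * k) (add_mset 1 (replicate_mset (n - 1) t))"
    using root by (subst (1 2) k, subst chom_Suc_add_mset) (simp add: phi_eq_chom n add_mset_commute)
  moreover have "chom (2 * k) (add_mset 1 (replicate_mset n t)) = chom (2 * k) (replicate_mset n t)"
    using root by (subst (1 2) k, subst chom_Suc_add_mset) (simp add: phi_eq_chom)
  moreover have "add_mset 1 (replicate_mset n t) = add_mset t (add_mset 1 (replicate_mset (n - 1) t))"
    by (simp add: n add_mset_commute)
  ultimately show ?thesis
    by (simp add: complete_hom_eq_chom chom_replicate)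
qed

text \<open>
  Smoothing the variables other than \<open>1\<close> to their mean \<open>\<mu>\<close> reduces the bound to the comparison of
  \<open>\<mu>\<close> with \<open>t\<close> in the one-variable problem.
\<close>
lemma chom_with_one_ge:
  assumes "k \<ge> 1" and root: "phi k (Suc (size M)) t = 0"
  shows "chom (2 * k) (add_mset 1 (replicate_mset (size M) t)) \<le> chom (2 * k) (add_mset 1 M)"
proof -
  define m where "m = 2 * (k - 1)"
  have m: "2 * k = m + 2" "2 * k - 1 = Suc m"
    using assms(1) by (simp_all add: m_def)
  have nonneg: "0 \<le> chom m N" for N :: "real multiset"
    unfolding m_def by (rule chom_even_nonneg)
  define \<mu> where "\<mu> = sum_mset M / real (size M)"
  have mean: "sum_mset M = real (size M) * \<mu>"
    by (cases "M = {#}") (simp_all add: \<mu>_def)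
  have "chom (Suc m) (replicate_mset (Suc (size M)) t + {#1#}) = 0"
    using root by (simp add: phi_eq_chom m add_mset_commute)
  then have "chom (m + 2) (replicate_mset (size M) t + {#1#})
      \<le> chom (m + 2) (replicate_mset (size M) \<mu> + {#1#})"
    by (rule chom_critical_le[OF nonneg])
  also have "\<dots> \<le> chom (m + 2) (M + {#1#})"
    by (rule chom_mean_le[OF nonneg mean])
  finally show ?thesis
    by (simp add: m)
qed

lemma max_sphere_minimum:
  assumes "k \<ge> 1" and root: "phi k n t = 0" and x: "x \<in> max_sphere n" and "n \<ge> 1"
  shows "complete_hom (2 * k) (replicate (n - 1) t @ [1]) \<le> complete_hom (2 * k) x"
proof -
  have len: "length x = n" and "Max (abs ` set x) = 1"
    using x by (simp_all add: max_sphere_def max_norm_def)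
  moreover have "abs ` set x \<noteq> {}"
    using len \<open>n \<ge> 1\<close> by auto
  ultimately have "1 \<in> abs ` set x"
    using Max_in[of "abs ` set x"] by simp
  then obtain c where c: "c \<in> set x" "\<bar>c\<bar> = 1"
    by auto
  then obtain M where M: "mset x = add_mset c M"
    by (metis multi_member_split set_mset_mset)
  \<comment> \<open>As \<open>c\<^sup>2 = 1\<close>, multiplying all variables by \<open>c\<close> turns \<open>c\<close> into \<open>1\<close> and leaves \<open>h\<^sub>2\<^sub>k\<close> unchanged.\<close>
  let ?M = "image_mset ((*) c) M"
  have cc: "c * c = 1"
    using c(2) by (metis abs_mult_self_eq mult_1)
  have size: "size ?M = n - 1" "Suc (size ?M) = n"
    using len M \<open>n \<ge> 1\<close> by (metis size_mset size_add_mset size_image_mset diff_Suc_1)+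
  have "complete_hom (2 * k) (replicate (n - 1) t @ [1])
      = chom (2 * k) (add_mset 1 (replicate_mset (size ?M) t))"
    by (simp add: complete_hom_eq_chom size del: size_image_mset)
  also have "\<dots> \<le> chom (2 * k) (add_mset 1 ?M)"
    using chom_with_one_ge[OF assms(1), of ?M t] root size(2) by simp
  also have "\<dots> = chom (2 * k) (image_mset ((*) c) (mset x))"
    by (simp add: M cc)
  also have "\<dots> = complete_hom (2 * k) x"
    unfolding chom_homogeneous complete_hom_eq_chom by (simp add: power_mult power2_eq_square cc)
  finally show ?thesis .
qed

lemma replicate_one_in_max_sphere:
  assumes "n \<ge> 1" and "\<bar>t\<bar> \<le> 1"
  shows "replicate (n - 1) t @ [1] \<in> max_sphere n"
proof -
  have "Max (abs ` set (replicate (n - 1) t @ [1])) = 1"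
    using assms(2) by (intro Max_eqI) auto
  then show ?thesis
    using assms(1) by (simp add: max_sphere_def max_norm_def)
qed

theorem theorem6p1:
  fixes n k :: nat
  assumes "n \<ge> 2" and "k \<ge> 1"
  shows "(\<exists>!t. t \<in> {-1<..<0} \<and> phi k n t = 0) \<and>
    (\<forall>t. t \<in> {-1<..<0} \<and> phi k n t = 0 \<longrightarrow>
       is_arg_min (complete_hom (2 * k)) (\<lambda>x. x \<in> max_sphere n) (replicate (n - 1) t @ [1]) \<and>
       complete_hom (2 * k) (replicate (n - 1) t @ [1]) = real ((n + 2 * k - 1) choose (2 * k)) * t ^ (2 * k))"
proof -
  let ?v = "\<lambda>t. replicate (n - 1) t @ [1::real]"
  have n: "n \<ge> 1"
    using assms(1) by simp
  note val = complete_hom_at_root[OF n assms(2)]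
  note min = max_sphere_minimum[OF assms(2) _ _ n]
  have mem: "?v t \<in> max_sphere n" if "t \<in> {-1<..<0}" for t
    using that by (intro replicate_one_in_max_sphere[OF n]) auto
  have unique: "s = t"
    if "s \<in> {-1<..<0}" "phi k n s = 0" "t \<in> {-1<..<0}" "phi k n t = 0" for s t
  proof -
    have "complete_hom (2 * k) (?v s) = complete_hom (2 * k) (?v t)"
      using that min[of s] min[of t] mem by (meson antisym)
    moreover have "(n + 2 * k - 1) choose (2 * k) > 0"
      using n by simp
    ultimately have "s ^ (2 * k) = t ^ (2 * k)"
      unfolding val[OF that(2)] val[OF that(4)] by simp
    then have "\<bar>s\<bar> = \<bar>t\<bar>"
      using power_eq_iff_eq_base[of "2 * k" "\<bar>s\<bar>" "\<bar>t\<bar>"] assms(2) by (simp add: power_even_abs)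
    with that show ?thesis
      by simp
  qed
  obtain t where "t \<in> {-1<..<0}" "phi k n t = 0"
    by (rule phi_root_exists[OF assms])
  then have "\<exists>!t. t \<in> {-1<..<0} \<and> phi k n t = 0"
    using unique by blast
  moreover have "is_arg_min (complete_hom (2 * k)) (\<lambda>x. x \<in> max_sphere n) (?v t)"
    if "t \<in> {-1<..<0}" "phi k n t = 0" for t
    using mem[OF that(1)] min[OF that(2)] by (auto simp: is_arg_min_def not_less simp del: One_nat_def)
  ultimately show ?thesis
    using val by blast
qed

end
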